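(* Let $P\subset\mathbb{R}^n$ be an $n$-dimensional lattice polytope with Santaló point $\chi$. Then $\operatorname{vol}(P^\chi)\le\dfrac{(n+1)^{n+1}}{n!}$, with equality if and only if $P$ is unimodularly equivalent to the standard simplex $\operatorname{conv}\{0,e_1,\dots,e_n\}$.
   Context: Lattice polytope: convex hull of finitely many points of $\mathbb{Z}^n$. For a convex body $K$ with the origin in its interior, $K^*=\{y:\langle x,y\rangle\le1\ \forall x\in K\}$. The Santaló point of a convex body $P$ with nonempty interior is the unique interior point $\chi$ minimizing $\operatorname{vol}((P-\chi)^* )$; write $P^\chi=(P-\chi)^*$. Volume is Lebesgue measure. *)

theory Defs
  imports "HOL-Analysis.Analysis"
begin

text \<open>Integer points of R^n.\<close>
definition integral_vec :: "real^'n \<Rightarrow> bool" where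
  "integral_vec x \<longleftrightarrow> (\<forall>i. x $ i \<in> \<int>)"

text \<open>Lattice polytope: convex hull of finitely many integer points.\<close>
definition lattice_polytope :: "(real^'n) set \<Rightarrow> bool" where
  "lattice_polytope P \<longleftrightarrow>
     (\<exists>S. finite S \<and> (\<forall>x\<in>S. integral_vec x) \<and> P = convex hull S)"

text \<open>Polar body K^* = {y. <x,y> <= 1 for all x in K}.\<close>
definition polar :: "(real^'n) set \<Rightarrow> (real^'n) set" where
  "polar K = {y. \<forall>x\<in>K. inner x y \<le> 1}"

text \<open>P^c = (P - c)^*.\<close>
definition polar_at :: "(real^'n) set \<Rightarrow> real^'n \<Rightarrow> (real^'n) set" where
  "polar_at P c = polar ((\<lambda>x. x - c) ` P)"

text \<open>chi is the Santalo point of P: an interior point minimizing vol((P - chi)^*)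
  over all interior points (such a minimizer is unique).\<close>
definition santalo_point :: "(real^'n) set \<Rightarrow> real^'n \<Rightarrow> bool" where
  "santalo_point P chi \<longleftrightarrow> chi \<in> interior P \<and>
     (\<forall>c\<in>interior P. emeasure lebesgue (polar_at P chi) \<le> emeasure lebesgue (polar_at P c))"

text \<open>Standard simplex conv{0, e_1, ..., e_n}.\<close>
definition std_simplex :: "(real^'n) set" where
  "std_simplex = convex hull (insert 0 (range (\<lambda>i. axis i 1)))"

text \<open>Unimodular equivalence: P = U Q + t with U an integer matrix of determinant
  +-1 and t an integer vector.\<close>
definition unimodular_equiv :: "(real^'n) set \<Rightarrow> (real^'n) set \<Rightarrow> bool" where
  "unimodular_equiv P Q \<longleftrightarrow>
     (\<exists>(U::real^'n^'n) t. (\<forall>i j. U $ i $ j \<in> \<int>) \<and> \<bar>det U\<bar> = 1 \<and> integral_vec t \<and>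
        P = (\<lambda>x. U *v x + t) ` Q)"

end

theory Submission
  imports Defs
begin

text \<open>A full-dimensional lattice polytope \<open>P\<close> contains a lattice simplex \<open>T = U \<Delta> + t\<close>, where
  \<open>\<Delta>\<close> is the standard simplex and \<open>U\<close> is an integer matrix, so \<open>\<bar>det U\<bar> \<ge> 1\<close>. Taking \<open>c\<close> to be the
  barycenter of \<open>T\<close>, the body \<open>(T - c)\<^sup>*\<close> is a linear image of the polar of \<open>\<Delta>\<close> at its barycenter,
  so its volume is \<open>(n + 1)\<^sup>n\<^sup>+\<^sup>1 / n!\<close> divided by \<open>\<bar>det U\<bar>\<close>. As the Santalo point minimizes the
  polar volume and polarity reverses inclusion,
  \<open>vol(P\<^sup>\<chi>) \<le> vol((P - c)\<^sup>*) \<le> vol((T - c)\<^sup>*) \<le> (n + 1)\<^sup>n\<^sup>+\<^sup>1 / n!\<close>.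
  Equality forces \<open>\<bar>det U\<bar> = 1\<close> and \<open>P = T\<close>, because a point of \<open>P\<close> outside \<open>T\<close> cuts an open set
  out of \<open>(T - c)\<^sup>*\<close>. Conversely, the polar of \<open>\<Delta>\<close> at an interior point \<open>c\<close> has volume
  \<open>1 / (n! (1 - \<Sum>c\<^sub>i) \<Prod>c\<^sub>i)\<close>, which by AM-GM is at least \<open>(n + 1)\<^sup>n\<^sup>+\<^sup>1 / n!\<close>.\<close>

section \<open>Lebesgue measure of linear images\<close>

lemma det_shear_matrix:
  fixes m n :: "'n::finite"
  assumes "m \<noteq> n"
  shows "det (matrix (\<lambda>x::real^'n. \<chi> i. if i = m then x $ m + x $ n else x $ i)) = 1"
proof -
  have "matrix (\<lambda>x::real^'n. \<chi> i. if i = m then x $ m + x $ n else x $ i)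
     = (\<chi> k. if k = m then row m (mat 1) + 1 *s row n (mat 1) else row k (mat 1 :: real^'n^'n))"
    by (auto simp: matrix_def vec_eq_iff axis_def row_def mat_def)
  then show ?thesis
    using det_row_operation[OF assms, of "mat 1 :: real^'n^'n" 1] by simp
qed

lemma abs_det_swap_matrix:
  "\<bar>det (matrix (\<lambda>x::real^'n. \<chi> i. x $ Transposition.transpose m n i))\<bar> = 1"
proof -
  have "matrix (\<lambda>x::real^'n. \<chi> i. x $ Transposition.transpose m n i)
      = (\<chi> i. mat 1 $ Transposition.transpose m n i :: real^'n^'n)"
    by (auto simp: matrix_def vec_eq_iff axis_def mat_def)
  then show ?thesis
    by (simp add: det_permute_rows permutes_swap_id sign_swap_id abs_mult)
qed

lemma measure_linear_image_from_cboxes: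
  fixes h :: "real^'n \<Rightarrow> real^'n"
  assumes "linear h" "\<bar>det (matrix h)\<bar> = 1" "S \<in> lmeasurable"
    and "\<And>a b. cbox a b \<noteq> {} \<Longrightarrow> measure lebesgue (h ` cbox a b) = measure lebesgue (cbox a b)"
  shows "h ` S \<in> lmeasurable \<and> measure lebesgue (h ` S) = \<bar>det (matrix h)\<bar> * measure lebesgue S"
proof -
  have "h ` S \<in> lmeasurable \<and> 1 * measure lebesgue S = measure lebesgue (h ` S)"
  proof (rule measure_linear_sufficient[OF assms(1,3)])
    show "measure lebesgue (h ` cbox a b) = 1 * measure lebesgue (cbox a b)" for a b
      using assms(4) by (cases "cbox a b = {}") auto
  qed
  then show ?thesis
    using assms(2) by simp
qed

lemma measure_shear_cbox:
  fixes m n :: "'n::finite"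
  assumes "m \<noteq> n" "cbox a b \<noteq> {}"
  shows "measure lebesgue ((\<lambda>x::real^'n. \<chi> i. if i = m then x $ m + x $ n else x $ i) ` cbox a b)
       = measure lebesgue (cbox a b)"
proof -
  let ?h = "\<lambda>x::real^'n. \<chi> i. if i = m then x $ m + x $ n else x $ i"
  have lin: "linear ?h"
    by (rule linearI) (auto simp: vec_eq_iff algebra_simps)
  have box: "cbox a b = (+) a ` cbox 0 (b - a)"
    using cbox_translation[of a 0 "b - a"] by simp
  have "?h ` cbox a b = (+) (?h a) ` ?h ` cbox 0 (b - a)"
    unfolding box image_image by (simp add: linear_add[OF lin])
  then have "measure lebesgue (?h ` cbox a b) = measure lebesgue (?h ` cbox 0 (b - a))"
    by (simp add: measure_translation)
  also have "\<dots> = measure lebesgue (cbox 0 (b - a))"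
    using assms box by (intro measure_shear_interval) auto
  also have "\<dots> = measure lebesgue (cbox a b)"
    by (simp add: box measure_translation)
  finally show ?thesis .
qed

lemma measure_swap_cbox:
  "measure lebesgue ((\<lambda>x::real^'n. \<chi> i. x $ Transposition.transpose m n i) ` cbox a b)
       = measure lebesgue (cbox a b)"
proof (cases "cbox a b = {}")
  case False
  let ?h = "\<lambda>x::real^'n. \<chi> i. x $ Transposition.transpose m n i"
  have eq: "?h ` cbox a b = cbox (?h a) (?h b)"
    by (auto simp: image_iff lambda_swap_Galois mem_box_cart) (metis transpose_involutory)+
  then have "?h ` cbox a b \<noteq> {}"
    using False by blast
  then show ?thesis
    using prod.permute [OF permutes_swap_id, where S=UNIV and g="\<lambda>i. (b - a)$i", symmetric]
    by (simp add: eq content_cbox_cart False)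
qed simp

text \<open>The library's \<open>measure_linear_image\<close> requires a well-ordered index type; the same
  induction over elementary matrices works for any finite one.\<close>
proposition
  fixes f :: "real^'n \<Rightarrow> real^'n"
  assumes "linear f" "S \<in> lmeasurable"
  shows measurable_linear_image_cart: "f ` S \<in> lmeasurable"
    and measure_linear_image_cart:
      "measure lebesgue (f ` S) = \<bar>det (matrix f)\<bar> * measure lebesgue S"
proof -
  let ?P = "\<lambda>f::real^'n \<Rightarrow> real^'n. \<forall>S \<in> lmeasurable.
     f ` S \<in> lmeasurable \<and> measure lebesgue (f ` S) = \<bar>det (matrix f)\<bar> * measure lebesgue S"
  have "?P f"
  proof (rule induct_linear_elementary[OF \<open>linear f\<close>])
    fix g h :: "real^'n \<Rightarrow> real^'n"
    assume "linear g" "linear h" "?P g" "?P h"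
    show "?P (g \<circ> h)"
    proof
      fix S :: "(real^'n) set"
      assume "S \<in> lmeasurable"
      with \<open>?P h\<close> have "h ` S \<in> lmeasurable"
        and hS: "measure lebesgue (h ` S) = \<bar>det (matrix h)\<bar> * measure lebesgue S"
        by blast+
      with \<open>?P g\<close> have "g ` h ` S \<in> lmeasurable"
        and "measure lebesgue (g ` h ` S) = \<bar>det (matrix g)\<bar> * measure lebesgue (h ` S)"
        by blast+
      then show "(g \<circ> h) ` S \<in> lmeasurable \<and> measure lebesgue ((g \<circ> h) ` S)
          = \<bar>det (matrix (g \<circ> h))\<bar> * measure lebesgue S"
        unfolding image_comp[symmetric] matrix_compose[OF \<open>linear h\<close> \<open>linear g\<close>]
        by (simp add: hS abs_mult det_mul)
    qed
  next
    fix g :: "real^'n \<Rightarrow> real^'n" and i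
    assume "linear g" "\<And>x. g x $ i = 0"
    then have "\<not> inj g"
      by (metis (full_types) linear_injective_imp_surjective one_neq_zero surjE vec_component)
    then have "det (matrix g) = 0" "negligible (g ` S)" for S
      using det_nz_iff_inj[OF \<open>linear g\<close>] negligible_linear_singular_image[OF \<open>linear g\<close>] by auto
    then show "?P g"
      by (simp add: negligible_imp_measurable negligible_imp_measure0)
  next
    fix c :: "'n \<Rightarrow> real"
    show "?P (\<lambda>x. \<chi> i. c i * x $ i)"
      by (simp add: measurable_stretch measure_stretch matrix_def axis_def det_diagonal)
  next
    fix m n :: 'n
    show "?P (\<lambda>x. \<chi> i. x $ Transposition.transpose m n i)"
      by (intro ballI measure_linear_image_from_cboxes abs_det_swap_matrix measure_swap_cbox)
        (auto intro: linearI simp: vec_eq_iff)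
  next
    fix m n :: 'n
    assume "m \<noteq> n"
    then show "?P (\<lambda>x. \<chi> i. if i = m then x $ m + x $ n else x $ i)"
      by (intro ballI measure_linear_image_from_cboxes measure_shear_cbox)
        (auto intro: linearI simp: det_shear_matrix vec_eq_iff algebra_simps)
  qed
  with assms show "f ` S \<in> lmeasurable" "measure lebesgue (f ` S) = \<bar>det (matrix f)\<bar> * measure lebesgue S"
    by auto
qed

section \<open>The standard simplex and polar bodies\<close>

lemma Basis_cart: "(Basis :: (real^'n) set) = range (\<lambda>i. axis i 1)"
  by (auto simp: Basis_vec_def)

lemma sum_Basis_inner_cart: "(\<Sum>b\<in>Basis. x \<bullet> b) = (\<Sum>i\<in>UNIV. x $ i)" for x :: "real^'n"
proof -
  have "inj (\<lambda>i::'n. axis i (1::real))"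
    by (auto simp: inj_on_def axis_eq_axis)
  then show ?thesis
    by (simp add: Basis_cart sum.reindex inner_axis)
qed

lemma ball_Basis_cart: "(\<forall>b\<in>(Basis :: (real^'n) set). P b) \<longleftrightarrow> (\<forall>i. P (axis i 1))"
  by (simp add: Basis_cart)

lemma std_simplex_Basis: "std_simplex = convex hull (insert 0 (Basis :: (real^'n) set))"
  by (simp add: std_simplex_def Basis_cart)

lemma std_simplex_cart:
  "(std_simplex :: (real^'n) set) = {x. (\<forall>i. 0 \<le> x $ i) \<and> (\<Sum>i\<in>UNIV. x $ i) \<le> 1}"
  by (simp add: std_simplex_Basis std_simplex sum_Basis_inner_cart ball_Basis_cart inner_axis)

lemma interior_std_simplex_cart:
  "interior (std_simplex :: (real^'n) set) = {x. (\<forall>i. 0 < x $ i) \<and> (\<Sum>i\<in>UNIV. x $ i) < 1}"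
  by (simp add: std_simplex_Basis interior_std_simplex sum_Basis_inner_cart ball_Basis_cart inner_axis)

lemma compact_std_simplex: "compact (std_simplex :: (real^'n) set)"
  by (simp add: std_simplex_def finite_imp_compact_convex_hull)

lemma measure_std_simplex: "measure lebesgue (std_simplex :: (real^'n) set) = 1 / fact CARD('n)"
  using content_std_simplex[where 'a="real^'n"] compact_std_simplex[where 'n='n]
  by (simp add: std_simplex_Basis measure_completion compact_imp_closed)

lemma polar_antimono: "A \<subseteq> B \<Longrightarrow> polar B \<subseteq> polar A"
  unfolding polar_def by blast

lemma closed_polar: "closed (polar K)"
proof -
  have "polar K = (\<Inter>x\<in>K. {y. x \<bullet> y \<le> 1})"
    by (auto simp: polar_def)
  then show ?thesis
    by (simp add: closed_INT closed_halfspace_le)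
qed

lemma polar_convex_hull: "polar (convex hull V) = polar V"
proof
  show "polar (convex hull V) \<subseteq> polar V"
    by (simp add: hull_subset polar_antimono)
  show "polar V \<subseteq> polar (convex hull V)"
  proof
    fix y
    assume "y \<in> polar V"
    then have "convex hull V \<subseteq> {x. y \<bullet> x \<le> 1}"
      by (intro hull_minimal convex_halfspace_le) (auto simp: polar_def inner_commute)
    then show "y \<in> polar (convex hull V)"
      by (auto simp: polar_def inner_commute)
  qed
qed

lemma polar_at_convex_hull: "polar_at (convex hull V) c = polar ((\<lambda>x. x - c) ` V)"
  using convex_hull_translation[of "- c" V] polar_convex_hull[of "(\<lambda>x. x - c) ` V"]
  by (simp add: polar_at_def)

lemma polar_at_antimono: "A \<subseteq> B \<Longrightarrow> polar_at B c \<subseteq> polar_at A c"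
  unfolding polar_at_def by (intro polar_antimono image_mono)

lemma compact_polar_at:
  assumes "c \<in> interior P"
  shows "compact (polar_at P c)"
proof -
  obtain r where "r > 0" and r: "cball c r \<subseteq> P"
    using assms mem_interior_cball by blast
  have "norm y \<le> 1 / r" if y: "y \<in> polar_at P c" for y
  proof (cases "y = 0")
    case False
    have "c + (r / norm y) *\<^sub>R y \<in> P"
      using r \<open>r > 0\<close> by (auto simp: dist_norm)
    then have "(r / norm y) *\<^sub>R y \<bullet> y \<le> 1"
      using y by (force simp: polar_at_def polar_def)
    then have "r * norm y \<le> 1"
      using False by (simp add: power2_norm_eq_inner[symmetric] power2_eq_square)
    with \<open>r > 0\<close> show ?thesis
      by (simp add: field_simps)
  qed (use \<open>r > 0\<close> in simp)
  then have "bounded (polar_at P c)"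
    by (auto simp: bounded_iff)
  then show ?thesis
    by (simp add: compact_eq_bounded_closed polar_at_def closed_polar)
qed

lemma lmeasurable_polar_at: "c \<in> interior P \<Longrightarrow> polar_at P c \<in> lmeasurable"
  by (simp add: compact_polar_at lmeasurable_compact)

lemma measure_polar_at_antimono:
  assumes "A \<subseteq> B" "c \<in> interior A"
  shows "measure lebesgue (polar_at B c) \<le> measure lebesgue (polar_at A c)"
proof (rule measure_mono_fmeasurable)
  show "polar_at B c \<subseteq> polar_at A c"
    using assms(1) by (rule polar_at_antimono)
  show "polar_at B c \<in> sets lebesgue"
    using assms interior_mono lmeasurable_polar_at by blast
  show "polar_at A c \<in> lmeasurable"
    using assms(2) by (rule lmeasurable_polar_at)
qed

section \<open>The polar of the standard simplex\<close>

lemma det_identity_replace_row: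
  fixes x :: "real^'n"
  shows "det (\<chi> i j. if i = k then x $ j else mat 1 $ i $ j) = x $ k"
proof -
  have "(\<chi> i j. if i = k then x $ j else mat 1 $ i $ j) =
    (\<chi> i. if i = k then (\<Sum>i\<in>UNIV. x $ i *s row i (mat 1)) else row i (mat 1 :: real^'n^'n))"
    by (auto simp: vec_eq_iff row_def mat_def if_distrib cong: if_cong)
  then show ?thesis
    using cramer_lemma_transpose[of k x "mat 1 :: real^'n^'n"] by simp
qed

lemma det_identity_replace_column:
  fixes x :: "real^'n"
  shows "det (\<chi> i j. if j = k then x $ i else mat 1 $ i $ j) = x $ k"
  using cramer_lemma[of k "mat 1 :: real^'n^'n" x]
  by (simp only: matrix_vector_mul_lid det_I mult_1_right)

text \<open>Matrix determinant lemma. With \<open>E\<close> the identity with column \<open>k\<close> replaced by \<open>a\<close>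
  (where \<open>a $ k \<noteq> 0\<close>), conjugation by \<open>E\<close> turns \<open>I + a b\<^sup>T\<close> into the identity with row \<open>k\<close>
  replaced by a vector whose \<open>k\<close>-th entry is \<open>1 + b \<bullet> a\<close>.\<close>
lemma det_identity_plus_outer:
  fixes a b :: "real^'n"
  shows "det (\<chi> i j. mat 1 $ i $ j + a $ i * b $ j) = 1 + b \<bullet> a"
proof (cases "a = 0")
  case False
  then obtain k where ak: "a $ k \<noteq> 0"
    by (auto simp: vec_eq_iff)
  define M where "M = ((\<chi> i j. mat 1 $ i $ j + a $ i * b $ j) :: real^'n^'n)"
  define E where "E = ((\<chi> i j. if j = k then a $ i else mat 1 $ i $ j) :: real^'n^'n)"
  define r where "r = ((\<chi> j. if j = k then 1 + b \<bullet> a else b $ j) :: real^'n)"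
  define N where "N = ((\<chi> i j. if i = k then r $ j else mat 1 $ i $ j) :: real^'n^'n)"
  have "(M ** E) $ i $ j = (E ** N) $ i $ j" for i j
  proof -
    have "(M ** E) $ i $ j = (if j = k then a $ i + a $ i * (b \<bullet> a) else mat 1 $ i $ j + a $ i * b $ j)"
      by (auto simp: matrix_matrix_mult_def M_def E_def mat_def distrib_right sum.distrib
          inner_vec_def sum_distrib_left algebra_simps if_distrib[of "\<lambda>x. x * y" for y]
          if_distrib[of "times z" for z] sum.delta' cong: if_cong)
    moreover have "(E ** N) $ i $ j = E $ i $ k * N $ k $ j + (\<Sum>l\<in>UNIV - {k}. E $ i $ l * N $ l $ j)"
      by (simp add: matrix_matrix_mult_def sum.remove)
    moreover have "(\<Sum>l\<in>UNIV - {k}. E $ i $ l * N $ l $ j) = (if i = k then 0 else mat 1 $ i $ j)"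
      by (simp add: E_def N_def mat_def if_distrib[of "\<lambda>x. x * y" for y] sum.delta' cong: if_cong)
    ultimately show ?thesis
      by (auto simp: E_def N_def r_def mat_def algebra_simps)
  qed
  then have "det M * det E = det E * det N"
    by (metis det_mul vec_eq_iff)
  moreover have "det E = a $ k"
    unfolding E_def by (rule det_identity_replace_column)
  moreover have "det N = 1 + b \<bullet> a"
    unfolding N_def by (simp add: det_identity_replace_row r_def)
  ultimately show ?thesis
    using ak by (simp add: M_def)
qed simp

lemma polar_at_std_simplex:
  "polar_at std_simplex c = {y. - (c \<bullet> y) \<le> 1 \<and> (\<forall>i. y $ i - c \<bullet> y \<le> 1)}"
  by (auto simp: std_simplex_def polar_at_convex_hull polar_def inner_diff_left inner_axis')

text \<open>The affine map \<open>y \<mapsto> polar_std_matrix c *v y + c\<close>, with coordinates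
  \<open>c$i * (1 + c \<bullet> y - y$i)\<close>, sends the \<open>n + 1\<close> facet inequalities of \<open>(std_simplex - c)\<^sup>*\<close> to
  those of \<open>std_simplex\<close>.\<close>
definition polar_std_matrix :: "real^'n \<Rightarrow> real^'n^'n" where
  "polar_std_matrix c = (\<chi> i j. c $ i * (c $ j - mat 1 $ i $ j))"

lemma polar_std_matrix_apply: "(polar_std_matrix c *v y) $ i = c $ i * (c \<bullet> y - y $ i)"
  by (simp add: polar_std_matrix_def matrix_vector_mult_def inner_vec_def algebra_simps sum_subtractf
      sum_distrib_left mat_def if_distrib[of "times z" for z] cong: if_cong)

lemma polar_at_std_simplex_vimage:
  fixes c :: "real^'n"
  assumes "c \<in> interior std_simplex"
  shows "polar_at std_simplex c = (\<lambda>y. polar_std_matrix c *v y + c) -` std_simplex"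
proof -
  define s where "s = (\<Sum>i\<in>UNIV. c $ i)"
  have c: "\<And>i. 0 < c $ i" and "s < 1"
    using assms by (auto simp: interior_std_simplex_cart s_def)
  have "0 \<le> (polar_std_matrix c *v y + c) $ i \<longleftrightarrow> y $ i - c \<bullet> y \<le> 1" for y i
  proof -
    have "(polar_std_matrix c *v y + c) $ i = c $ i * (1 + c \<bullet> y - y $ i)"
      by (simp add: polar_std_matrix_apply algebra_simps)
    with c[of i] show ?thesis
      by (auto simp: zero_le_mult_iff)
  qed
  moreover have "(\<Sum>i\<in>UNIV. (polar_std_matrix c *v y + c) $ i) \<le> 1 \<longleftrightarrow> - (c \<bullet> y) \<le> 1" for y
  proof -
    have "(\<Sum>i\<in>UNIV. (polar_std_matrix c *v y + c) $ i) = s * (c \<bullet> y) - (\<Sum>i\<in>UNIV. c $ i * y $ i) + s"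
      by (simp add: polar_std_matrix_apply s_def right_diff_distrib sum.distrib sum_subtractf
          sum_distrib_right)
    also have "\<dots> = 1 - (1 - s) * (1 + c \<bullet> y)"
      by (simp add: inner_vec_def algebra_simps)
    finally show ?thesis
      using \<open>s < 1\<close> by (auto simp: zero_le_mult_iff)
  qed
  ultimately show ?thesis
    unfolding polar_at_std_simplex by (auto simp: std_simplex_cart)
qed

lemma abs_det_polar_std_matrix:
  fixes c :: "real^'n"
  assumes "c \<in> interior std_simplex"
  shows "\<bar>det (polar_std_matrix c)\<bar> = (\<Prod>i\<in>UNIV. c $ i) * (1 - (\<Sum>i\<in>UNIV. c $ i))"
proof -
  define D where "D = ((\<chi> i j. if i = j then - c $ i else 0) :: real^'n^'n)"
  define R where "R = ((\<chi> i j. mat 1 $ i $ j + (- 1) * c $ j) :: real^'n^'n)"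
  have c: "\<And>i. 0 < c $ i" and "(\<Sum>i\<in>UNIV. c $ i) < 1"
    using assms by (auto simp: interior_std_simplex_cart)
  have "(D ** R) $ i $ j = - c $ i * R $ i $ j" for i j
    by (simp add: D_def matrix_matrix_mult_def if_distrib[of "\<lambda>x. x * y" for y] cong: if_cong)
  then have "polar_std_matrix c = D ** R"
    by (simp add: polar_std_matrix_def R_def vec_eq_iff algebra_simps)
  then have "det (polar_std_matrix c) = (\<Prod>i\<in>UNIV. - c $ i) * (1 - (\<Sum>i\<in>UNIV. c $ i))"
    using det_identity_plus_outer[of "\<chi> i. - 1" c]
    by (simp add: det_mul D_def R_def det_diagonal inner_vec_def sum_negf)
  with c \<open>(\<Sum>i\<in>UNIV. c $ i) < 1\<close> show ?thesis
    by (simp add: abs_mult abs_prod abs_of_pos)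
qed

lemma measure_polar_at_std_simplex:
  fixes c :: "real^'n"
  assumes "c \<in> interior std_simplex"
  shows "measure lebesgue (polar_at std_simplex c)
       = 1 / (fact CARD('n) * (1 - (\<Sum>i\<in>UNIV. c $ i)) * (\<Prod>i\<in>UNIV. c $ i))"
proof -
  let ?A = "polar_std_matrix c"
  have "0 < \<bar>det ?A\<bar>"
    using assms unfolding abs_det_polar_std_matrix[OF assms]
    by (auto simp: interior_std_simplex_cart prod_pos)
  then have "surj ((*v) ?A)"
    using det_nz_iff_inj linear_injective_imp_surjective matrix_vector_mul_linear
    by (metis abs_zero less_irrefl matrix_of_matrix_vector_mul)
  then have "surj (\<lambda>y. ?A *v y + c)"
    by (metis (no_types, lifting) diff_add_cancel surj_def)
  then have "(\<lambda>y. ?A *v y + c) ` polar_at std_simplex c = std_simplex"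
    unfolding polar_at_std_simplex_vimage[OF assms] by (rule surj_image_vimage_eq)
  moreover have "(\<lambda>y. ?A *v y + c) ` X = (+) c ` (*v) ?A ` X" for X :: "(real^'n) set"
    by (simp add: image_image add.commute)
  ultimately have "measure lebesgue (std_simplex :: (real^'n) set)
      = measure lebesgue ((*v) ?A ` polar_at std_simplex c)"
    by (metis measure_translation)
  also have "\<dots> = \<bar>det ?A\<bar> * measure lebesgue (polar_at std_simplex c)"
    using measure_linear_image_cart[OF matrix_vector_mul_linear lmeasurable_polar_at[OF assms]]
    by (simp add: matrix_of_matrix_vector_mul)
  finally have "measure lebesgue (polar_at std_simplex c) = 1 / (fact CARD('n) * \<bar>det ?A\<bar>)"
    using \<open>0 < \<bar>det ?A\<bar>\<close> by (simp add: measure_std_simplex field_simps)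
  then show ?thesis
    by (simp add: abs_det_polar_std_matrix[OF assms] mult_ac)
qed

lemma prod_le_mean_power:
  fixes x :: "'a \<Rightarrow> real"
  assumes "finite S" "S \<noteq> {}" "\<And>i. i \<in> S \<Longrightarrow> 0 \<le> x i"
  shows "(\<Prod>i\<in>S. x i) \<le> ((\<Sum>i\<in>S. x i) / card S) ^ card S"
proof -
  define p where "p = (\<Prod>i\<in>S. x i)"
  have "p powr (1 / card S) \<le> (\<Sum>i\<in>S. x i) / card S"
    using arith_geom_mean[OF assms] by (simp add: p_def sum_divide_distrib)
  moreover have "p = (p powr (1 / card S)) ^ card S"
  proof (cases "p = 0")
    case False
    with assms have "0 < p"
      by (simp add: p_def less_le prod_nonneg)
    with assms(1,2) show ?thesis
      by (simp add: powr_realpow[symmetric] powr_powr)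
  qed (use assms in \<open>simp add: card_gt_0_iff\<close>)
  ultimately have "p \<le> ((\<Sum>i\<in>S. x i) / card S) ^ card S"
    by (metis power_mono powr_ge_zero)
  then show ?thesis
    by (simp add: p_def)
qed

definition std_barycenter :: "real^'n" where
  "std_barycenter = (\<chi> i. 1 / real (CARD('n) + 1))"

lemma std_barycenter_in_interior: "std_barycenter \<in> interior std_simplex"
  by (simp add: interior_std_simplex_cart std_barycenter_def)

lemma measure_polar_at_std_barycenter:
  "measure lebesgue (polar_at std_simplex (std_barycenter :: real^'n))
     = real (CARD('n) + 1) ^ (CARD('n) + 1) / fact CARD('n)"
proof -
  let ?N = "real (CARD('n) + 1)"
  have "1 - (\<Sum>i\<in>UNIV. (std_barycenter :: real^'n) $ i) = 1 / ?N"
    by (simp add: std_barycenter_def field_simps)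
  moreover have "(\<Prod>i\<in>UNIV. (std_barycenter :: real^'n) $ i) = (1 / ?N) ^ CARD('n)"
    by (simp add: std_barycenter_def)
  ultimately show ?thesis
    unfolding measure_polar_at_std_simplex[OF std_barycenter_in_interior]
    by (simp add: power_one_over)
qed

text \<open>AM-GM applied to the \<open>n + 1\<close> barycentric coordinates \<open>1 - \<Sum>c, c$1, \<dots>, c$n\<close> of \<open>c\<close>.\<close>
lemma measure_polar_at_std_simplex_ge:
  fixes c :: "real^'n"
  assumes "c \<in> interior std_simplex"
  shows "real (CARD('n) + 1) ^ (CARD('n) + 1) / fact CARD('n) \<le> measure lebesgue (polar_at std_simplex c)"
proof -
  define q where "q = (1 - (\<Sum>i\<in>UNIV. c $ i)) * (\<Prod>i\<in>UNIV. c $ i)"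
  define K where "K = real (CARD('n) + 1) ^ (CARD('n) + 1)"
  define x where "x = (\<lambda>w. case w of None \<Rightarrow> 1 - (\<Sum>i\<in>UNIV. c $ i) | Some i \<Rightarrow> c $ i)"
  have c: "\<And>i. 0 < c $ i" and s: "(\<Sum>i\<in>UNIV. c $ i) < 1"
    using assms by (auto simp: interior_std_simplex_cart)
  have "(\<Prod>w\<in>UNIV. x w) \<le> ((\<Sum>w\<in>UNIV. x w) / CARD('n option)) ^ CARD('n option)"
    using c s by (intro prod_le_mean_power) (auto simp: x_def less_imp_le split: option.split)
  moreover have "(\<Prod>w\<in>UNIV. x w) = q"
    by (simp add: UNIV_option_conv prod.reindex x_def q_def)
  moreover have "(\<Sum>w\<in>UNIV. x w) = 1"
    by (simp add: UNIV_option_conv sum.reindex x_def)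
  ultimately have "K * q \<le> 1"
    by (simp add: K_def card_UNIV_option power_one_over field_simps del: of_nat_Suc)
  have "0 < q"
    using c s by (simp add: q_def prod_pos)
  then have "K / fact CARD('n) = K * q / (fact CARD('n) * q)"
    by simp
  also have "\<dots> \<le> 1 / (fact CARD('n) * q)"
    using \<open>K * q \<le> 1\<close> \<open>0 < q\<close> by (intro divide_right_mono) auto
  finally show ?thesis
    by (simp add: measure_polar_at_std_simplex[OF assms] K_def q_def mult.assoc)
qed

section \<open>Affine invariance and monotonicity of polar volumes\<close>

lemma interior_affine_image_cart:
  fixes U :: "real^'n^'n"
  assumes "det U \<noteq> 0"
  shows "interior ((\<lambda>x. U *v x + t) ` S) = (\<lambda>x. U *v x + t) ` interior S"
proof -
  have "inj ((*v) U)"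
    using assms det_nz_iff_inj[OF matrix_vector_mul_linear[of U]] by (simp add: matrix_of_matrix_vector_mul)
  moreover have "(\<lambda>x. U *v x + t) ` X = (+) t ` (*v) U ` X" for X
    by (auto simp: image_image add.commute)
  ultimately show ?thesis
    by (simp add: interior_translation interior_injective_linear_image)
qed

lemma inner_matrix_vector_mult_transpose: "(U *v x) \<bullet> y = x \<bullet> (transpose U *v y)"
  for U :: "real^'n^'m"
  by (metis dot_lmul_matrix inner_commute transpose_matrix_vector)

lemma polar_at_affine_image:
  fixes U W :: "real^'n^'n"
  assumes "W ** transpose U = mat 1" "transpose U ** W = mat 1"
  shows "polar_at ((\<lambda>x. U *v x + t) ` Q) (U *v c + t) = (*v) W ` polar_at Q c"
proof -
  have mem: "y \<in> polar_at ((\<lambda>x. U *v x + t) ` Q) (U *v c + t) \<longleftrightarrow> transpose U *v y \<in> polar_at Q c" for y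
  proof -
    have "(U *v x + t) - (U *v c + t) = U *v (x - c)" for x
      by (simp add: matrix_vector_mult_diff_distrib)
    then show ?thesis
      by (simp add: polar_at_def polar_def inner_matrix_vector_mult_transpose image_image
          del: transpose_matrix_vector)
  qed
  show ?thesis
  proof (intro set_eqI iffI)
    fix y
    assume "y \<in> polar_at ((\<lambda>x. U *v x + t) ` Q) (U *v c + t)"
    moreover have "y = W *v (transpose U *v y)"
      by (simp add: matrix_vector_mul_assoc assms(1) del: transpose_matrix_vector)
    ultimately show "y \<in> (*v) W ` polar_at Q c"
      using mem by blast
  next
    fix y
    assume "y \<in> (*v) W ` polar_at Q c"
    moreover have "transpose U *v (W *v z) = z" for z
      by (simp add: matrix_vector_mul_assoc assms(2) del: transpose_matrix_vector)
    ultimately show "y \<in> polar_at ((\<lambda>x. U *v x + t) ` Q) (U *v c + t)"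
      using mem by auto
  qed
qed

lemma measure_polar_at_affine_image:
  fixes U :: "real^'n^'n"
  assumes "det U \<noteq> 0" "c \<in> interior Q"
  shows "measure lebesgue (polar_at ((\<lambda>x. U *v x + t) ` Q) (U *v c + t))
       = measure lebesgue (polar_at Q c) / \<bar>det U\<bar>"
proof -
  obtain W where W: "W ** transpose U = mat 1" "transpose U ** W = mat 1"
    using assms(1) invertible_det_nz[of "transpose U"] unfolding invertible_def by auto
  have "det W * det U = 1"
    using arg_cong[OF W(1), of det] by (simp add: det_mul)
  then have "\<bar>det W\<bar> = 1 / \<bar>det U\<bar>"
    using assms(1) by (simp add: abs_mult[symmetric] eq_divide_eq)
  then show ?thesis
    using measure_linear_image_cart[OF matrix_vector_mul_linear lmeasurable_polar_at[OF assms(2)], of W]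
    by (simp add: polar_at_affine_image[OF W] matrix_of_matrix_vector_mul)
qed

text \<open>A point \<open>p \<in> P\<close> outside \<open>T\<close> is strictly separated from \<open>T\<close>; the suitably scaled
  normal of the separating hyperplane is such a point of \<open>(T - c)\<^sup>*\<close>.\<close>
lemma polar_at_polytope_open_gap:
  assumes "polytope T" "T \<subseteq> P" "T \<noteq> P" "c \<in> interior T"
  obtains N where "open N" "N \<noteq> {}" "N \<subseteq> polar_at T c" "N \<inter> polar_at P c = {}"
proof -
  obtain V where "finite V" and T: "T = convex hull V"
    using assms(1) polytope_def by blast
  obtain p where "p \<in> P" "p \<notin> T"
    using assms(2,3) by blast
  let ?K = "(\<lambda>x. x - c) ` T"
  have "convex ?K" "closed ?K"
    using \<open>finite V\<close> by (auto simp: T convex_translation_subtract compact_imp_closed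
        compact_translation_subtract finite_imp_compact_convex_hull)
  moreover have "p - c \<notin> ?K"
    using \<open>p \<notin> T\<close> by auto
  ultimately obtain a \<beta> where a: "a \<bullet> (p - c) < \<beta>" "\<forall>x\<in>?K. \<beta> < a \<bullet> x"
    using separating_hyperplane_closed_point by blast
  have "0 \<in> ?K"
    using assms(4) interior_subset by force
  with a have "\<beta> < 0"
    by force
  define N where "N = {y. 1 < (p - c) \<bullet> y} \<inter> (\<Inter>v\<in>V. {y. (v - c) \<bullet> y < 1})"
  show thesis
  proof
    show "open N"
      unfolding N_def using \<open>finite V\<close>
      by (intro open_Int open_INT ballI) (auto simp: open_halfspace_gt open_halfspace_lt)
    have "(1 / \<beta>) *\<^sub>R a \<in> N"
      using a \<open>\<beta> < 0\<close> hull_subset[of V convex]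
      by (fastforce simp: N_def T inner_commute divide_less_eq less_divide_eq)
    then show "N \<noteq> {}"
      by blast
    show "N \<subseteq> polar_at T c"
      unfolding T polar_at_convex_hull polar_def N_def by (auto intro: less_imp_le)
    show "N \<inter> polar_at P c = {}"
      using \<open>p \<in> P\<close> unfolding N_def polar_at_def polar_def by force
  qed
qed

lemma measure_polar_at_strict_antimono:
  assumes "polytope T" "T \<subseteq> P" "T \<noteq> P" "c \<in> interior T"
  shows "measure lebesgue (polar_at P c) < measure lebesgue (polar_at T c)"
proof -
  obtain N where N: "open N" "N \<noteq> {}" "N \<subseteq> polar_at T c" "N \<inter> polar_at P c = {}"
    using polar_at_polytope_open_gap[OF assms] by blast
  have T: "polar_at T c \<in> lmeasurable" and P: "polar_at P c \<in> lmeasurable"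
    using assms interior_mono lmeasurable_polar_at by blast+
  have "bounded N"
    using N(3) compact_polar_at[OF assms(4)] by (meson bounded_subset compact_imp_bounded)
  with N(1) have "N \<in> lmeasurable"
    by (rule lmeasurable_open[rotated])
  moreover have "\<not> negligible N"
    using N(1,2) open_not_negligible by blast
  ultimately have "0 < measure lebesgue N"
    by (simp add: negligible_iff_measure0 order.strict_iff_order)
  have "measure lebesgue (polar_at P c) \<le> measure lebesgue (polar_at T c - N)"
    using N(4) polar_at_antimono[OF assms(2)] P T \<open>N \<in> lmeasurable\<close>
    by (intro measure_mono_fmeasurable) auto
  also have "\<dots> = measure lebesgue (polar_at T c) - measure lebesgue N"
    using T \<open>N \<in> lmeasurable\<close> N(3) by (intro measure_Diff) (auto simp: fmeasurable_def)
  finally show ?thesis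
    using \<open>0 < measure lebesgue N\<close> by simp
qed

lemma santalo_point_measure_le:
  assumes "santalo_point P chi" "c \<in> interior P"
  shows "measure lebesgue (polar_at P chi) \<le> measure lebesgue (polar_at P c)"
proof -
  have "chi \<in> interior P"
    and "emeasure lebesgue (polar_at P chi) \<le> emeasure lebesgue (polar_at P c)"
    using assms unfolding santalo_point_def by auto
  with assms(2) show ?thesis
    by (simp add: emeasure_eq_measure2 lmeasurable_polar_at)
qed

section \<open>Lattice simplices\<close>

lemma det_Ints:
  fixes U :: "real^'n^'n"
  assumes "\<forall>i j. U $ i $ j \<in> \<int>"
  shows "det U \<in> \<int>"
  unfolding det_def using assms by (intro Ints_sum Ints_mult Ints_prod) auto

lemma one_le_abs_det_Ints:
  fixes U :: "real^'n^'n"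
  assumes "\<forall>i j. U $ i $ j \<in> \<int>" "det U \<noteq> 0"
  shows "1 \<le> \<bar>det U\<bar>"
proof -
  obtain k where "det U = of_int k"
    using det_Ints[OF assms(1)] Ints_cases by blast
  with assms(2) show ?thesis
    by simp
qed

lemma affine_image_std_simplex:
  fixes f :: "'n \<Rightarrow> real^'n"
  shows "(\<lambda>x. (\<chi> i j. f j $ i - v $ i) *v x + v) ` std_simplex = convex hull (insert v (range f))"
proof -
  let ?U = "(\<chi> i j. f j $ i - v $ i) :: real^'n^'n"
  have "(\<lambda>x. ?U *v x + v) ` std_simplex = (+) v ` (*v) ?U ` std_simplex"
    by (auto simp: image_image add.commute)
  also have "\<dots> = convex hull ((+) v ` (*v) ?U ` insert 0 (range (\<lambda>i. axis i 1)))"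
    unfolding std_simplex_def convex_hull_linear_image[OF matrix_vector_mul_linear]
    by (rule convex_hull_translation[symmetric])
  also have "(+) v ` (*v) ?U ` insert 0 (range (\<lambda>i. axis i 1)) = insert v (range f)"
    by (auto simp: image_image matrix_vector_mult_basis column_def vec_eq_iff)
  finally show ?thesis .
qed

lemma polytope_affine_image_std_simplex:
  fixes U :: "real^'n^'n"
  shows "polytope ((\<lambda>x. U *v x + t) ` std_simplex)"
proof -
  have "polytope (std_simplex :: (real^'n) set)"
    unfolding polytope_def std_simplex_def by (intro exI[of _ "insert 0 (range (\<lambda>i. axis i 1))"]) simp
  then have "polytope ((+) t ` (*v) U ` std_simplex)"
    by (simp add: polytope_translation_eq polytope_linear_image)
  then show ?thesis
    by (simp add: image_image add.commute)
qed

lemma full_dimensional_hull_contains_simplex: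
  fixes S :: "(real^'n) set"
  assumes "finite S" "interior (convex hull S) \<noteq> {}"
  obtains v f where "v \<in> S" "\<And>j. f j \<in> S" "det (\<chi> i j. f j $ i - v $ i) \<noteq> 0"
proof -
  obtain B where B: "B \<subseteq> S" "\<not> affine_dependent B" "affine hull S = affine hull B"
    using affine_basis_exists[of S] by blast
  have "aff_dim (convex hull S) = int CARD('n)"
    using aff_dim_nonempty_interior[OF assms(2)] by simp
  then have "aff_dim B = int CARD('n)"
    using B(3) by (metis aff_dim_affine_hull aff_dim_convex_hull)
  then have "card B = CARD('n) + 1"
    using aff_dim_affine_independent[OF B(2)] by linarith
  then obtain v where "v \<in> B"
    by (metis card.empty ex_in_conv add_is_0 zero_neq_one)
  define B' where "B' = B - {v}"
  have "finite B"
    using B(1) assms(1) finite_subset by blast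
  then have "card B' = CARD('n)"
    using \<open>card B = CARD('n) + 1\<close> \<open>v \<in> B\<close> by (simp add: B'_def)
  then obtain f where f: "bij_betw f (UNIV :: 'n set) B'"
    using \<open>finite B\<close> finite_same_card_bij[of "UNIV :: 'n set" B'] by (auto simp: B'_def)
  let ?U = "(\<chi> i j. f j $ i - v $ i) :: real^'n^'n"
  have "independent ((\<lambda>x. - v + x) ` B')"
    using affine_dependent_iff_dependent[of v B'] B(2) \<open>v \<in> B\<close> by (simp add: B'_def insert_absorb)
  moreover have "columns ?U = (\<lambda>x. - v + x) ` B'"
  proof -
    have "column j ?U = - v + f j" for j
      by (simp add: column_def vec_eq_iff)
    then show ?thesis
      using bij_betw_imp_surj_on[OF f] by (auto simp: columns_def)
  qed
  ultimately have "rank ?U = CARD('n)"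
    using \<open>card B' = CARD('n)\<close> by (simp add: column_rank_def dim_eq_card_independent card_image)
  then have "det ?U \<noteq> 0"
    by (simp add: det_eq_0_rank)
  moreover have "v \<in> S" "f j \<in> S" for j
    using \<open>v \<in> B\<close> B(1) bij_betwE[OF f] by (auto simp: B'_def)
  ultimately show ?thesis
    using that by blast
qed

lemma lattice_polytope_contains_lattice_simplex:
  fixes P :: "(real^'n) set"
  assumes "lattice_polytope P" "interior P \<noteq> {}"
  obtains U t where "\<forall>i j. U $ i $ j \<in> \<int>" "det U \<noteq> 0" "integral_vec t"
    "(\<lambda>x. U *v x + t) ` std_simplex \<subseteq> P"
proof -
  obtain S where "finite S" "\<forall>x\<in>S. integral_vec x" and P: "P = convex hull S"
    using assms(1) unfolding lattice_polytope_def by blast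
  moreover obtain v f where "v \<in> S" "\<And>j. f j \<in> S" "det (\<chi> i j. f j $ i - v $ i) \<noteq> 0"
    using full_dimensional_hull_contains_simplex \<open>finite S\<close> assms(2) P by blast
  ultimately show ?thesis
    using that[of "\<chi> i j. f j $ i - v $ i" v]
    by (auto simp: affine_image_std_simplex integral_vec_def intro!: hull_mono)
qed

lemma measure_polar_at_unimodular_simplex_ge:
  fixes P :: "(real^'n) set"
  assumes "unimodular_equiv P std_simplex" "chi \<in> interior P"
  shows "real (CARD('n) + 1) ^ (CARD('n) + 1) / fact CARD('n) \<le> measure lebesgue (polar_at P chi)"
proof -
  obtain V :: "real^'n^'n" and t where "\<bar>det V\<bar> = 1" and P: "P = (\<lambda>x. V *v x + t) ` std_simplex"
    using assms(1) unfolding unimodular_equiv_def by blast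
  then have "det V \<noteq> 0"
    by auto
  then obtain c where c: "c \<in> interior std_simplex" "chi = V *v c + t"
    using assms(2) unfolding P interior_affine_image_cart[OF \<open>det V \<noteq> 0\<close>] by blast
  have "measure lebesgue (polar_at P chi) = measure lebesgue (polar_at std_simplex c)"
    unfolding P c(2) measure_polar_at_affine_image[OF \<open>det V \<noteq> 0\<close> c(1)] \<open>\<bar>det V\<bar> = 1\<close> by simp
  with measure_polar_at_std_simplex_ge[OF c(1)] show ?thesis
    by simp
qed

lemma santalo_point_measure_le_simplex:
  fixes P :: "(real^'n) set" and U :: "real^'n^'n"
  assumes "santalo_point P chi" "det U \<noteq> 0" "(\<lambda>x. U *v x + t) ` std_simplex \<subseteq> P"
  defines "B \<equiv> real (CARD('n) + 1) ^ (CARD('n) + 1) / fact CARD('n) / \<bar>det U\<bar>"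
  shows "measure lebesgue (polar_at P chi) \<le> B"
    and "measure lebesgue (polar_at P chi) = B \<Longrightarrow> P = (\<lambda>x. U *v x + t) ` std_simplex"
proof -
  define T where "T = (\<lambda>x. U *v x + t) ` std_simplex"
  define c where "c = U *v std_barycenter + t"
  have "T \<subseteq> P"
    using assms(3) by (simp add: T_def)
  have "c \<in> interior T"
    using std_barycenter_in_interior unfolding T_def c_def interior_affine_image_cart[OF assms(2)] by blast
  have measure_T: "measure lebesgue (polar_at T c) = B"
    by (simp add: T_def c_def B_def measure_polar_at_affine_image[OF assms(2) std_barycenter_in_interior]
        measure_polar_at_std_barycenter)
  have chi_le_c: "measure lebesgue (polar_at P chi) \<le> measure lebesgue (polar_at P c)"
    using santalo_point_measure_le[OF assms(1)] \<open>c \<in> interior T\<close> \<open>T \<subseteq> P\<close> interior_mono by blast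
  then show "measure lebesgue (polar_at P chi) \<le> B"
    using measure_polar_at_antimono[OF \<open>T \<subseteq> P\<close> \<open>c \<in> interior T\<close>] measure_T by linarith
  show "P = T" if "measure lebesgue (polar_at P chi) = B"
  proof (rule ccontr)
    assume "P \<noteq> T"
    then have "measure lebesgue (polar_at P c) < measure lebesgue (polar_at T c)"
      using polytope_affine_image_std_simplex \<open>T \<subseteq> P\<close> \<open>c \<in> interior T\<close>
      by (intro measure_polar_at_strict_antimono) (auto simp: T_def)
    with chi_le_c that measure_T show False
      by simp
  qed
qed

theorem lemma4p2:
  fixes P :: "(real^'n) set" and chi :: "real^'n"
  assumes "lattice_polytope P"
    and "interior P \<noteq> {}"
    and "santalo_point P chi"
  shows "measure lebesgue (polar_at P chi) \<le> real (CARD('n) + 1) ^ (CARD('n) + 1) / fact (CARD('n))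
     \<and> (measure lebesgue (polar_at P chi) = real (CARD('n) + 1) ^ (CARD('n) + 1) / fact (CARD('n))
          \<longleftrightarrow> unimodular_equiv P std_simplex)"
proof -
  let ?B = "real (CARD('n) + 1) ^ (CARD('n) + 1) / fact CARD('n)"
  obtain U t where U: "\<forall>i j. U $ i $ j \<in> \<int>" "det U \<noteq> 0" "integral_vec t"
    and UP: "(\<lambda>x. U *v x + t) ` std_simplex \<subseteq> P"
    using lattice_polytope_contains_lattice_simplex[OF assms(1,2)] by blast
  note bound = santalo_point_measure_le_simplex[OF assms(3) U(2) UP]
  have "1 \<le> \<bar>det U\<bar>"
    using one_le_abs_det_Ints[OF U(1,2)] .
  then have "?B / \<bar>det U\<bar> \<le> ?B"
    by (simp add: divide_le_eq)
  with bound(1) have upper: "measure lebesgue (polar_at P chi) \<le> ?B"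
    by linarith
  have "unimodular_equiv P std_simplex" if "measure lebesgue (polar_at P chi) = ?B"
  proof -
    have "\<bar>det U\<bar> = 1"
      using bound(1) that \<open>1 \<le> \<bar>det U\<bar>\<close> by (simp add: le_divide_eq)
    with that have "P = (\<lambda>x. U *v x + t) ` std_simplex"
      by (intro bound(2)) simp
    with U \<open>\<bar>det U\<bar> = 1\<close> show ?thesis
      unfolding unimodular_equiv_def by blast
  qed
  moreover have "chi \<in> interior P"
    using assms(3) by (simp add: santalo_point_def)
  ultimately show ?thesis
    using upper measure_polar_at_unimodular_simplex_ge[of P chi] by (auto intro: antisym)
qed

end
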